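(* Assume: (1) there exists at least one contractive policy; (2) $U$ is a metric space, for all $i,j$ the functions $A_{ij}(\cdot)$ and $b(i,\cdot)$ are continuous on $U(i)$, and for each state $i$ the sets $\{u\in U(i)\mid b(i,u)+\sum_{j=1}^n A_{ij}(u)J(j)\le\lambda\}$ are compact subsets of $U$ for all $\lambda\in\mathbb{R}$ and all $J\in\mathbb{R}^n_+$; (3) for every noncontractive policy $\mu\in\mathcal{M}$ there is at least one state such that the corresponding component of the vector $\sum_{k=0}^\infty A_\mu^kb_\mu$ is equal to $\infty$. Then: (a) The optimal cost vector $J^*$ satisfies the Bellman equation $J=TJ$. Moreover, $J^*$ is the unique solution of this equation within $\mathbb{R}^n_+$. (b) Starting with any contractive policy $\mu^0$, the sequence $\{\mu^k\}$ generated by the policy iteration algorithm consists of contractive policies, and any limit point of this sequence is a contractive optimal policy. (c) For every vector $J\in\mathbb{R}^n_+$, $\lim_{k\to\infty}(T^kJ)(i)=J^*(i)$ for $i=1,\ldots,n$. (d) A stationary policy $\mu$ is optimal if and only if $T_\mu J^*=TJ^*$. (e) For a vector $J\in\mathbb{R}^n_+$, if $J\le TJ$ then $J\le J^*$, and if $J\ge TJ$ then $J\ge J^*$.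
   Context: Notation: $\mathbb{R}^n_+=\{J\mid 0\le J(i)<\infty,\ i=1,\ldots,n\}$ and $\mathcal{E}^n_+=\{J\mid 0\le J(i)\le\infty,\ i=1,\ldots,n\}$. Inequalities, limits, $\limsup$ and $\inf$ of vectors are componentwise. The convention $0\cdot\infty=0$ is used. Affine monotonic model: the state space is $\{1,\ldots,n\}$. There is a control space $U$ and, for each state $i$, a nonempty (possibly infinite) control constraint set $U(i)\subset U$. For all $i,j$ and $u\in U(i)$ there are given real scalars $b(i,u)\ge0$ and $A_{ij}(u)\ge0$. $\mathcal{M}$ is the set of all functions $\mu=(\mu(1),\ldots,\mu(n))$ with $\mu(i)\in U(i)$ for all $i$. A policy is a sequence $\pi=\{\mu_0,\mu_1,\ldots\}$ with $\mu_k\in\mathcal{M}$ for all $k$; $\Pi$ is the set of all policies. Each $\mu\in\mathcal{M}$ is identified with the stationary policy $\{\mu,\mu,\ldots\}$. For $\mu\in\mathcal{M}$, $b_\mu\in\mathbb{R}^n$ is the vector with components $b(i,\mu(i))$ and $A_\mu$ is the $n\times n$ matrix with components $A_{ij}(\mu(i))$. The mappings $T_\mu,T:\mathcal{E}^n_+\to\mathcal{E}^n_+$ are $$T_\mu J=b_\mu+A_\mu J,\qquad (TJ)(i)=\inf_{u\in U(i)}\Big[b(i,u)+\sum_{j=1}^nA_{ij}(u)J(j)\Big],\quad i=1,\ldots,n.$$ A vector $\bar J\in\mathbb{R}^n_+$ is fixed. The cost function of $\pi=\{\mu_0,\mu_1,\ldots\}$ is $J_\pi=\limsup_{N\to\infty}T_{\mu_0}\cdots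 T_{\mu_{N-1}}\bar J$; that of a stationary policy $\mu$ is $J_\mu=\limsup_{N\to\infty}T_\mu^N\bar J$. The optimal cost function is $J^*(i)=\inf_{\pi\in\Pi}J_\pi(i)$, and a policy $\pi$ is optimal if $J_\pi=J^*$ (so a stationary $\mu$ is optimal if $J_\mu=J^*$). A stationary policy $\mu\in\mathcal{M}$ is called contractive if $A_\mu^N\to0$ as $N\to\infty$ (equivalently, all eigenvalues of $A_\mu$ lie strictly inside the unit circle), and noncontractive otherwise. Policy iteration algorithm: starting from a contractive policy $\mu^0$, it generates a sequence $\{\mu^k\}\subset\mathcal{M}$; given $\mu^k$, it computes $J_{\mu^k}$ using the policy evaluation equation $J_{\mu^k}=T_{\mu^k}J_{\mu^k}$, and then chooses $\mu^{k+1}\in\mathcal{M}$ (any such policy) satisfying $T_{\mu^{k+1}}J_{\mu^k}=TJ_{\mu^k}$. Limit points of $\{\mu^k\}$ are understood componentwise, viewing $\mu^k=(\mu^k(1),\ldots,\mu^k(n))$ as an element of $U^n$ with the product topology. *)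

theory Defs
  imports "HOL-Analysis.Analysis"
begin

text \<open>
  States are the elements of a finite type \<open>'n\<close>; the control space is a type \<open>'u\<close>, with the
  constraint sets given by \<open>U\<close>. Vectors with components in \<open>[0,\<infinity>]\<close> are functions
  \<open>'n \<Rightarrow> ennreal\<close>, ordered pointwise; multiplication on \<^typ>\<open>ennreal\<close> satisfies \<open>0 * \<infinity> = 0\<close>.
  The values \<open>b i u\<close> and \<open>A i j u\<close> are meaningful (and assumed nonnegative) only for
  \<open>u \<in> U i\<close>.
\<close>

definition finite_vecs :: "('n \<Rightarrow> ennreal) set" where
  "finite_vecs = {J. \<forall>i. J i < \<infinity>}"

definition stat_policies :: "('n \<Rightarrow> 'u set) \<Rightarrow> ('n \<Rightarrow> 'u) set" where
  "stat_policies U = {\<mu>. \<forall>i. \<mu> i \<in> U i}"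

definition policies :: "('n \<Rightarrow> 'u set) \<Rightarrow> (nat \<Rightarrow> 'n \<Rightarrow> 'u) set" where
  "policies U = {\<pi>. \<forall>k. \<pi> k \<in> stat_policies U}"

definition b_vec :: "('n::finite \<Rightarrow> 'u \<Rightarrow> real) \<Rightarrow> ('n \<Rightarrow> 'u) \<Rightarrow> real ^ 'n" where
  "b_vec b \<mu> = (\<chi> i. b i (\<mu> i))"

definition A_mat :: "('n::finite \<Rightarrow> 'n \<Rightarrow> 'u \<Rightarrow> real) \<Rightarrow> ('n \<Rightarrow> 'u) \<Rightarrow> real ^ 'n ^ 'n" where
  "A_mat A \<mu> = (\<chi> i j. A i j (\<mu> i))"

text \<open>
  Power with respect to the matrix product \<open>**\<close>; the multiplication \<open>*\<close> of the type
  \<^typ>\<open>real ^ 'n ^ 'n\<close> is componentwise.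
\<close>

primrec mat_power :: "real ^ 'n ^ 'n \<Rightarrow> nat \<Rightarrow> real ^ 'n ^ 'n" where
  "mat_power M 0 = mat 1"
| "mat_power M (Suc k) = M ** mat_power M k"

definition stage_value ::
  "('n::finite \<Rightarrow> 'u \<Rightarrow> real) \<Rightarrow> ('n \<Rightarrow> 'n \<Rightarrow> 'u \<Rightarrow> real) \<Rightarrow> 'n \<Rightarrow> 'u \<Rightarrow> ('n \<Rightarrow> ennreal) \<Rightarrow> ennreal"
where
  "stage_value b A i u J = ennreal (b i u) + (\<Sum>j\<in>UNIV. ennreal (A i j u) * J j)"

definition T_pol ::
  "('n::finite \<Rightarrow> 'u \<Rightarrow> real) \<Rightarrow> ('n \<Rightarrow> 'n \<Rightarrow> 'u \<Rightarrow> real) \<Rightarrow> ('n \<Rightarrow> 'u) \<Rightarrow> ('n \<Rightarrow> ennreal) \<Rightarrow> 'n \<Rightarrow> ennreal"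
where
  "T_pol b A \<mu> J = (\<lambda>i. stage_value b A i (\<mu> i) J)"

definition T_opt ::
  "('n::finite \<Rightarrow> 'u set) \<Rightarrow> ('n \<Rightarrow> 'u \<Rightarrow> real) \<Rightarrow> ('n \<Rightarrow> 'n \<Rightarrow> 'u \<Rightarrow> real)
    \<Rightarrow> ('n \<Rightarrow> ennreal) \<Rightarrow> 'n \<Rightarrow> ennreal"
where
  "T_opt U b A J = (\<lambda>i. INF u\<in>U i. stage_value b A i u J)"

text \<open>The \<open>foldr\<close> is \<open>T\<^bsub>\<pi> 0\<^esub> (T\<^bsub>\<pi> 1\<^esub> (\<dots> (T\<^bsub>\<pi> (N-1)\<^esub> Jbar)))\<close>.\<close>

definition policy_cost ::
  "('n::finite \<Rightarrow> 'u \<Rightarrow> real) \<Rightarrow> ('n \<Rightarrow> 'n \<Rightarrow> 'u \<Rightarrow> real) \<Rightarrow> ('n \<Rightarrow> ennreal)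
    \<Rightarrow> (nat \<Rightarrow> 'n \<Rightarrow> 'u) \<Rightarrow> 'n \<Rightarrow> ennreal"
where
  "policy_cost b A Jbar \<pi> = (\<lambda>i. limsup (\<lambda>N. foldr (\<lambda>k. T_pol b A (\<pi> k)) [0..<N] Jbar i))"

definition stat_cost ::
  "('n::finite \<Rightarrow> 'u \<Rightarrow> real) \<Rightarrow> ('n \<Rightarrow> 'n \<Rightarrow> 'u \<Rightarrow> real) \<Rightarrow> ('n \<Rightarrow> ennreal)
    \<Rightarrow> ('n \<Rightarrow> 'u) \<Rightarrow> 'n \<Rightarrow> ennreal"
where
  "stat_cost b A Jbar \<mu> = (\<lambda>i. limsup (\<lambda>N. (T_pol b A \<mu> ^^ N) Jbar i))"

lemma policy_cost_const: "policy_cost b A Jbar (\<lambda>_. \<mu>) = stat_cost b A Jbar \<mu>"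
proof -
  have "foldr (\<lambda>k. T_pol b A \<mu>) [0..<N] J = (T_pol b A \<mu> ^^ N) J" for N J
    by (induction N arbitrary: J) (auto simp: funpow_swap1)
  then show ?thesis
    by (simp add: policy_cost_def stat_cost_def)
qed

definition opt_cost ::
  "('n::finite \<Rightarrow> 'u set) \<Rightarrow> ('n \<Rightarrow> 'u \<Rightarrow> real) \<Rightarrow> ('n \<Rightarrow> 'n \<Rightarrow> 'u \<Rightarrow> real)
    \<Rightarrow> ('n \<Rightarrow> ennreal) \<Rightarrow> 'n \<Rightarrow> ennreal"
where
  "opt_cost U b A Jbar = (\<lambda>i. INF \<pi>\<in>policies U. policy_cost b A Jbar \<pi> i)"

definition stat_optimal ::
  "('n::finite \<Rightarrow> 'u set) \<Rightarrow> ('n \<Rightarrow> 'u \<Rightarrow> real) \<Rightarrow> ('n \<Rightarrow> 'n \<Rightarrow> 'u \<Rightarrow> real)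
    \<Rightarrow> ('n \<Rightarrow> ennreal) \<Rightarrow> ('n \<Rightarrow> 'u) \<Rightarrow> bool"
where
  "stat_optimal U b A Jbar \<mu> \<longleftrightarrow>
     \<mu> \<in> stat_policies U \<and> stat_cost b A Jbar \<mu> = opt_cost U b A Jbar"

definition contractive ::
  "('n::finite \<Rightarrow> 'u set) \<Rightarrow> ('n \<Rightarrow> 'n \<Rightarrow> 'u \<Rightarrow> real) \<Rightarrow> ('n \<Rightarrow> 'u) \<Rightarrow> bool"
where
  "contractive U A \<mu> \<longleftrightarrow>
     \<mu> \<in> stat_policies U \<and> (\<lambda>N. mat_power (A_mat A \<mu>) N) \<longlonglongrightarrow> 0"

text \<open>
  The sequences that policy iteration can generate from a contractive starting policy: evaluation
  of \<open>\<mu> k\<close> by its fixed point equation, then an arbitrary choice of a minimizing \<open>\<mu> (Suc k)\<close>.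
\<close>

definition policy_iteration ::
  "('n::finite \<Rightarrow> 'u set) \<Rightarrow> ('n \<Rightarrow> 'u \<Rightarrow> real) \<Rightarrow> ('n \<Rightarrow> 'n \<Rightarrow> 'u \<Rightarrow> real)
    \<Rightarrow> ('n \<Rightarrow> ennreal) \<Rightarrow> (nat \<Rightarrow> 'n \<Rightarrow> 'u) \<Rightarrow> bool"
where
  "policy_iteration U b A Jbar \<mu> \<longleftrightarrow>
     contractive U A (\<mu> 0) \<and>
     (\<forall>k. \<mu> (Suc k) \<in> stat_policies U \<and>
          stat_cost b A Jbar (\<mu> k) = T_pol b A (\<mu> k) (stat_cost b A Jbar (\<mu> k)) \<and>
          T_pol b A (\<mu> (Suc k)) (stat_cost b A Jbar (\<mu> k)) = T_opt U b A (stat_cost b A Jbar (\<mu> k)))"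

text \<open>
  Limits of subsequences. For sequences of policies, the topology on \<open>'n \<Rightarrow> 'u\<close> is the
  product topology.
\<close>

definition seq_limit_point :: "(nat \<Rightarrow> 'a::topological_space) \<Rightarrow> 'a \<Rightarrow> bool" where
  "seq_limit_point f l \<longleftrightarrow> (\<exists>r. strict_mono r \<and> (f \<circ> r) \<longlonglongrightarrow> l)"

end

theory Submission
  imports Defs
begin

text \<open>
  Write \<open>J\<^sub>\<mu>\<close> for the vector of the series \<open>\<Sum>k. A\<^sub>\<mu>\<^sup>k b\<^sub>\<mu>\<close>. Everything rests on the expansion
  \<open>T\<^sub>\<mu>\<^sup>N J = (\<Sum>k<N. A\<^sub>\<mu>\<^sup>k b\<^sub>\<mu>) + A\<^sub>\<mu>\<^sup>N J\<close> (\<open>T_pol_funpow\<close>).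
  If \<open>\<mu>\<close> is contractive, the series is finite, because \<open>I - A\<^sub>\<mu>\<close> is invertible, and \<open>T\<^sub>\<mu>\<^sup>N J\<close> tends
  to \<open>J\<^sub>\<mu>\<close> from every finite \<open>J\<close>. Conversely, if \<open>T\<^sub>\<mu> J \<le> J\<close> for some finite \<open>J\<close>, the partial sums
  stay below \<open>J\<close>, so the series is finite and \<open>\<mu>\<close> cannot be noncontractive
  (\<open>contractive_if_T_pol_le\<close>). Hence a stationary policy that does not increase some finite vector
  is contractive, and its cost is below that vector.

  Compactness of the level sets has two main consequences, both from \<open>nested_level_sets\<close>: the
  infimum in \<open>T J\<close> is attained for finite \<open>J\<close>, and \<open>T\<close> fixes the increasing limit of \<open>T\<^sup>k 0\<close>, which
  is finite because it is bounded by \<open>J\<^sub>\<mu>\<close> for any contractive \<open>\<mu>\<close>. A finite fixed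
  point \<open>J\<close> is \<open>J\<^sub>\<mu>\<close> for a policy \<open>\<mu>\<close> attaining the infimum. If \<open>J'\<close> is another one, attained by
  \<open>\<nu>\<close>, then \<open>J = T J \<le> T\<^sub>\<nu> J\<close> gives \<open>J \<le> lim T\<^sub>\<nu>\<^sup>N J = J'\<close>, and by symmetry \<open>J = J'\<close>.

  For the fixed point \<open>J\<^sub>\<mu>\<close> and any finite \<open>J\<close>, the iterates \<open>T\<^sup>k J\<close> lie between \<open>T\<^sup>k 0\<close> and
  \<open>T\<^sub>\<mu>\<^sup>k J\<close>, which have the same limit \<open>J\<^sub>\<mu>\<close>; so value iteration converges. As the \<open>N\<close>-stage cost of
  every policy is at least \<open>T\<^sup>N J\<close> for the terminal vector \<open>J\<close>, the fixed point is the optimal cost.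
  In policy iteration the cost of the \<open>k\<close>-th policy is squeezed between the optimal cost and
  \<open>T\<^sup>k J\<close>, for \<open>J\<close> the cost of the starting policy; since level sets are closed, a limit point \<open>\<nu>\<close>
  satisfies \<open>T\<^sub>\<nu> J \<le> J\<close> for the optimal cost \<open>J\<close>, which makes it optimal.
\<close>

section \<open>Contractive matrices\<close>

lemma mat_power_fixed_point:
  fixes M :: "real ^ 'n::finite ^ 'n"
  assumes "x = M *v x + c"
  shows "(\<Sum>k<N. mat_power M k *v c) + mat_power M N *v x = x"
proof (induction N)
  case (Suc N)
  have "(\<Sum>k<Suc N. mat_power M k *v c) = c + M *v (\<Sum>k<N. mat_power M k *v c)"
    by (simp add: sum.lessThan_Suc_shift linear_sum[OF matrix_vector_mul_linear]
        matrix_vector_mul_assoc del: sum.lessThan_Suc)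
  then have "(\<Sum>k<Suc N. mat_power M k *v c) + mat_power M (Suc N) *v x
      = c + M *v ((\<Sum>k<N. mat_power M k *v c) + mat_power M N *v x)"
    by (simp add: matrix_vector_right_distrib matrix_vector_mul_assoc)
  also have "\<dots> = x"
    using Suc assms by (simp add: add.commute)
  finally show ?case .
qed simp

lemma mat_power_vector_tendsto_0:
  fixes M :: "real ^ 'n::finite ^ 'n"
  assumes "(\<lambda>N. mat_power M N) \<longlonglongrightarrow> 0"
  shows "(\<lambda>N. mat_power M N *v x) \<longlonglongrightarrow> 0"
proof (rule vec_tendstoI)
  fix i
  have "(\<lambda>N. mat_power M N $ i $ j * x $ j) \<longlonglongrightarrow> 0" for j
    using tendsto_mult_right[OF tendsto_vec_nth[OF tendsto_vec_nth[OF assms]]] by force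
  then show "(\<lambda>N. (mat_power M N *v x) $ i) \<longlonglongrightarrow> 0 $ i"
    unfolding matrix_vector_mult_def by (auto intro!: tendsto_null_sum)
qed

text \<open>
  If \<open>M x = x\<close> then \<open>x = M\<^sup>N x\<close> for all \<open>N\<close>, so \<open>x = 0\<close>. Thus \<open>I - M\<close> is injective, hence surjective,
  and the solution of \<open>x = M x + c\<close> is the sum of the Neumann series. This avoids both the spectral
  radius and a geometric bound on the powers.
\<close>

lemma Neumann_series_sums:
  fixes M :: "real ^ 'n::finite ^ 'n"
  assumes lim: "(\<lambda>N. mat_power M N) \<longlonglongrightarrow> 0"
  obtains x where "(\<lambda>k. mat_power M k *v c) sums x"
proof -
  have lin: "linear (\<lambda>x. x - M *v x)"
    by (intro linear_compose_sub linear_id[unfolded id_def] matrix_vector_mul_linear)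
  have "x = 0" if "x - M *v x = 0" for x
  proof -
    from that have "mat_power M N *v x = x" for N
      using mat_power_fixed_point[of x M 0 N] by simp
    with mat_power_vector_tendsto_0[OF lim, of x] show "x = 0"
      by (simp add: LIMSEQ_const_iff)
  qed
  then have "inj (\<lambda>x. x - M *v x)"
    using linear_injective_0[OF lin] by blast
  then have "surj (\<lambda>x. x - M *v x)"
    using linear_injective_imp_surjective[OF lin] by simp
  then obtain x where "c = x - M *v x"
    by (metis surjD)
  then have "x = M *v x + c"
    by simp
  then have "(\<Sum>k<N. mat_power M k *v c) = x - mat_power M N *v x" for N
    using mat_power_fixed_point[of x M c N] by (simp add: algebra_simps)
  then have "(\<lambda>k. mat_power M k *v c) sums x"
    using tendsto_diff[OF tendsto_const mat_power_vector_tendsto_0[OF lim, of x], of x]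
    by (simp add: sums_def)
  then show thesis ..
qed

section \<open>Monotone mappings\<close>

lemma stage_value_mono:
  "J \<le> J' \<Longrightarrow> stage_value b A i u J \<le> stage_value b A i u J'"
  unfolding stage_value_def
  by (intro add_left_mono sum_mono mult_left_mono) (auto simp: le_fun_def)

lemma mono_T_pol: "mono (T_pol b A \<mu>)"
  by (auto intro!: monoI le_funI stage_value_mono simp: T_pol_def)

lemma mono_T_opt: "mono (T_opt U b A)"
  by (auto intro!: monoI le_funI INF_mono' stage_value_mono simp: T_opt_def)

lemma T_opt_le_T_pol: "\<mu> \<in> stat_policies U \<Longrightarrow> T_opt U b A J \<le> T_pol b A \<mu> J"
  by (auto intro!: le_funI INF_lower simp: T_opt_def T_pol_def stat_policies_def)

lemma T_opt_funpow_le_T_pol_funpow: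
  assumes "\<mu> \<in> stat_policies U"
  shows "(T_opt U b A ^^ k) J \<le> (T_pol b A \<mu> ^^ k) J"
proof (induction k)
  case (Suc k)
  have "(T_opt U b A ^^ Suc k) J \<le> T_pol b A \<mu> ((T_opt U b A ^^ k) J)"
    using T_opt_le_T_pol[OF assms] by simp
  also have "\<dots> \<le> (T_pol b A \<mu> ^^ Suc k) J"
    using Suc monoD[OF mono_T_pol] by simp
  finally show ?case .
qed simp

lemma T_opt_funpow_le_foldr:
  assumes "\<pi> \<in> policies U"
  shows "(T_opt U b A ^^ N) J \<le> foldr (\<lambda>k. T_pol b A (\<pi> k)) [0..<N] J"
proof (induction N arbitrary: J)
  case (Suc N)
  have "T_opt U b A J \<le> T_pol b A (\<pi> N) J"
    using assms by (intro T_opt_le_T_pol) (simp add: policies_def)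
  then have "(T_opt U b A ^^ N) (T_opt U b A J) \<le> (T_opt U b A ^^ N) (T_pol b A (\<pi> N) J)"
    by (rule funpow_mono[OF mono_T_opt])
  also have "\<dots> \<le> foldr (\<lambda>k. T_pol b A (\<pi> k)) [0..<N] (T_pol b A (\<pi> N) J)"
    by (rule Suc)
  finally show ?case
    by (simp add: funpow_swap1)
qed simp

lemma funpow_le_of_le:
  assumes "mono f" "f x \<le> x"
  shows "(f ^^ k) x \<le> (x :: 'a :: order)"
  by (induction k) (use assms in \<open>auto intro: order_trans dest: monoD\<close>)

lemma le_funpow_of_le:
  assumes "mono f" "x \<le> f x"
  shows "x \<le> (f ^^ k) (x :: 'a :: order)"
  by (induction k) (use assms in \<open>auto intro: order_trans dest: monoD\<close>)

lemma stage_value_tendsto: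
  assumes "\<And>j. (\<lambda>k. J k j) \<longlonglongrightarrow> J' j"
  shows "(\<lambda>k. stage_value b A i u (J k)) \<longlonglongrightarrow> stage_value b A i u J'"
  unfolding stage_value_def
  by (intro tendsto_intros ennreal_tendsto_cmult assms) simp

lemma finite_vecs_mono: "J \<le> J' \<Longrightarrow> J' \<in> finite_vecs \<Longrightarrow> J \<in> finite_vecs"
  unfolding finite_vecs_def le_fun_def by (auto intro: le_less_trans)

lemma zero_in_finite_vecs: "(\<lambda>_. 0) \<in> finite_vecs"
  by (simp add: finite_vecs_def)

section \<open>Stationary policies\<close>

text \<open>
  The cost of \<open>\<mu>\<close> for the terminal vector \<open>0\<close>. For contractive policies it is the cost for every
  finite terminal vector (\<open>stat_cost_eq_cost\<close>), and in general it is a lower bound of the cost.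
\<close>

definition series_cost ::
  "('n::finite \<Rightarrow> 'u \<Rightarrow> real) \<Rightarrow> ('n \<Rightarrow> 'n \<Rightarrow> 'u \<Rightarrow> real) \<Rightarrow> ('n \<Rightarrow> 'u) \<Rightarrow> 'n \<Rightarrow> ennreal"
where
  "series_cost b A \<mu> = (\<lambda>i. \<Sum>k. ennreal ((mat_power (A_mat A \<mu>) k *v b_vec b \<mu>) $ i))"

locale affine_monotonic =
  fixes U :: "'n::finite \<Rightarrow> 'u::metric_space set"
    and b :: "'n \<Rightarrow> 'u \<Rightarrow> real"
    and A :: "'n \<Rightarrow> 'n \<Rightarrow> 'u \<Rightarrow> real"
  assumes U_nonempty: "\<And>i. U i \<noteq> {}"
    and b_nonneg: "\<And>i u. u \<in> U i \<Longrightarrow> 0 \<le> b i u"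
    and A_nonneg: "\<And>i j u. u \<in> U i \<Longrightarrow> 0 \<le> A i j u"
begin

abbreviation T where "T \<equiv> T_opt U b A"
abbreviation Tpol where "Tpol \<equiv> T_pol b A"
abbreviation cost where "cost \<equiv> series_cost b A"

lemma contractive_stat: "contractive U A \<mu> \<Longrightarrow> \<mu> \<in> stat_policies U"
  by (simp add: contractive_def)

lemma mat_power_nonneg:
  assumes "\<mu> \<in> stat_policies U"
  shows "0 \<le> mat_power (A_mat A \<mu>) k $ i $ j"
proof (induction k arbitrary: i j)
  case (Suc k)
  then show ?case
    using assms
    by (auto intro!: sum_nonneg mult_nonneg_nonneg A_nonneg
        simp: matrix_matrix_mult_def A_mat_def stat_policies_def)
qed (simp add: mat_def)

lemma mat_power_b_nonneg:
  assumes "\<mu> \<in> stat_policies U"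
  shows "0 \<le> (mat_power (A_mat A \<mu>) k *v b_vec b \<mu>) $ i"
  using assms mat_power_nonneg[OF assms]
  by (auto intro!: sum_nonneg mult_nonneg_nonneg b_nonneg
      simp: matrix_vector_mult_def b_vec_def stat_policies_def)

lemma T_pol_funpow:
  assumes \<mu>: "\<mu> \<in> stat_policies U"
  shows "(Tpol \<mu> ^^ N) J i =
    (\<Sum>k<N. ennreal ((mat_power (A_mat A \<mu>) k *v b_vec b \<mu>) $ i)) +
    (\<Sum>j\<in>UNIV. ennreal (mat_power (A_mat A \<mu>) N $ i $ j) * J j)"
proof (induction N arbitrary: i)
  case 0
  have "(\<Sum>j\<in>UNIV. ennreal (mat 1 $ i $ j) * J j) = (\<Sum>j\<in>UNIV. if i = j then J j else 0)"
    by (intro sum.cong) (auto simp: mat_def)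
  then show ?case
    by simp
next
  case (Suc N)
  let ?M = "A_mat A \<mu>" and ?b = "b_vec b \<mu>"
  have A: "0 \<le> A i j (\<mu> i)" for j
    using \<mu> by (auto simp: stat_policies_def intro: A_nonneg)
  have costs: "ennreal ((mat_power ?M (Suc k) *v ?b) $ i)
      = (\<Sum>j\<in>UNIV. ennreal (A i j (\<mu> i)) * ennreal ((mat_power ?M k *v ?b) $ j))" for k
  proof -
    have "(mat_power ?M (Suc k) *v ?b) $ i = (\<Sum>j\<in>UNIV. A i j (\<mu> i) * (mat_power ?M k *v ?b) $ j)"
      unfolding mat_power.simps matrix_vector_mul_assoc[symmetric]
      by (subst matrix_vector_mult_def) (simp add: A_mat_def)
    then show ?thesis
      using A mat_power_b_nonneg[OF \<mu>] by (simp add: ennreal_mult flip: sum_ennreal)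
  qed
  have weights: "ennreal (mat_power ?M (Suc N) $ i $ l)
      = (\<Sum>j\<in>UNIV. ennreal (A i j (\<mu> i)) * ennreal (mat_power ?M N $ j $ l))" for l
    using A mat_power_nonneg[OF \<mu>]
    by (simp add: matrix_matrix_mult_def A_mat_def ennreal_mult flip: sum_ennreal)
  have "(Tpol \<mu> ^^ Suc N) J i = ennreal (b i (\<mu> i)) +
      ((\<Sum>j\<in>UNIV. \<Sum>k<N. ennreal (A i j (\<mu> i)) * ennreal ((mat_power ?M k *v ?b) $ j)) +
       (\<Sum>j\<in>UNIV. \<Sum>l\<in>UNIV. ennreal (A i j (\<mu> i)) * (ennreal (mat_power ?M N $ j $ l) * J l)))"
    by (simp add: T_pol_def[of _ _ _ "(T_pol b A \<mu> ^^ N) J"] stage_value_def Suc distrib_left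
        sum.distrib sum_distrib_left)
  also have "(\<Sum>j\<in>UNIV. \<Sum>k<N. ennreal (A i j (\<mu> i)) * ennreal ((mat_power ?M k *v ?b) $ j))
      = (\<Sum>k<N. ennreal ((mat_power ?M (Suc k) *v ?b) $ i))"
    unfolding costs by (rule sum.swap)
  also have "(\<Sum>j\<in>UNIV. \<Sum>l\<in>UNIV. ennreal (A i j (\<mu> i)) * (ennreal (mat_power ?M N $ j $ l) * J l))
      = (\<Sum>l\<in>UNIV. ennreal (mat_power ?M (Suc N) $ i $ l) * J l)"
    unfolding weights by (subst sum.swap) (simp add: sum_distrib_right mult.assoc)
  also have "ennreal (b i (\<mu> i)) = ennreal ((mat_power ?M 0 *v ?b) $ i)"
    by (simp add: b_vec_def)
  finally show ?case
    by (simp only: sum.lessThan_Suc_shift add.assoc)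
qed

lemma cost_finite:
  assumes "contractive U A \<mu>"
  shows "cost \<mu> \<in> finite_vecs"
proof -
  have \<mu>: "\<mu> \<in> stat_policies U" and lim: "(\<lambda>N. mat_power (A_mat A \<mu>) N) \<longlonglongrightarrow> 0"
    using assms by (auto simp: contractive_def)
  obtain x where "(\<lambda>k. mat_power (A_mat A \<mu>) k *v b_vec b \<mu>) sums x"
    using Neumann_series_sums[OF lim] .
  then have "(\<lambda>k. (mat_power (A_mat A \<mu>) k *v b_vec b \<mu>) $ i) sums (x $ i)" for i
    unfolding sums_def using tendsto_vec_nth by fastforce
  then have "cost \<mu> i = ennreal (\<Sum>k. (mat_power (A_mat A \<mu>) k *v b_vec b \<mu>) $ i)" for i
    unfolding series_cost_def
    by (intro suminf_ennreal2 mat_power_b_nonneg[OF \<mu>] sums_summable)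
  then show ?thesis
    by (simp add: finite_vecs_def)
qed

lemma T_pol_funpow_tendsto_cost:
  assumes "contractive U A \<mu>" and J: "J \<in> finite_vecs"
  shows "(\<lambda>N. (Tpol \<mu> ^^ N) J i) \<longlonglongrightarrow> cost \<mu> i"
proof -
  have \<mu>: "\<mu> \<in> stat_policies U" and lim: "(\<lambda>N. mat_power (A_mat A \<mu>) N) \<longlonglongrightarrow> 0"
    using assms by (auto simp: contractive_def)
  have "(\<lambda>N. J j * ennreal (mat_power (A_mat A \<mu>) N $ i $ j)) \<longlonglongrightarrow> J j * ennreal 0" for j
    using J tendsto_vec_nth[OF tendsto_vec_nth[OF lim]]
    by (intro ennreal_tendsto_cmult tendsto_ennrealI) (auto simp: finite_vecs_def)
  then have "(\<lambda>N. \<Sum>j\<in>UNIV. ennreal (mat_power (A_mat A \<mu>) N $ i $ j) * J j) \<longlonglongrightarrow> 0"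
    by (intro tendsto_null_sum) (simp add: mult.commute)
  then show ?thesis
    unfolding T_pol_funpow[OF \<mu>] series_cost_def
    using tendsto_add[OF summable_LIMSEQ[OF summableI]] by fastforce
qed

lemma stat_cost_eq_cost:
  assumes "contractive U A \<mu>" "Jbar \<in> finite_vecs"
  shows "stat_cost b A Jbar \<mu> = cost \<mu>"
  unfolding stat_cost_def
  by (intro ext lim_imp_Limsup T_pol_funpow_tendsto_cost[OF assms]) simp

lemma T_pol_cost:
  assumes "contractive U A \<mu>"
  shows "Tpol \<mu> (cost \<mu>) = cost \<mu>"
proof
  fix i
  note lim = T_pol_funpow_tendsto_cost[OF assms zero_in_finite_vecs]
  have "(\<lambda>N. Tpol \<mu> ((Tpol \<mu> ^^ N) (\<lambda>_. 0)) i) \<longlonglongrightarrow> Tpol \<mu> (cost \<mu>) i"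
    unfolding T_pol_def[of _ _ _ "cost \<mu>"] T_pol_def[of _ _ _ "(Tpol \<mu> ^^ _) (\<lambda>_. 0)"]
    by (rule stage_value_tendsto[OF lim])
  moreover have "(\<lambda>N. Tpol \<mu> ((Tpol \<mu> ^^ N) (\<lambda>_. 0)) i) \<longlonglongrightarrow> cost \<mu> i"
    using LIMSEQ_Suc[OF lim] by simp
  ultimately show "Tpol \<mu> (cost \<mu>) i = cost \<mu> i"
    by (rule LIMSEQ_unique)
qed

lemma cost_le_stat_cost:
  assumes \<mu>: "\<mu> \<in> stat_policies U"
  shows "cost \<mu> \<le> stat_cost b A Jbar \<mu>"
proof (rule le_funI)
  fix i
  let ?p = "\<lambda>N. \<Sum>k<N. ennreal ((mat_power (A_mat A \<mu>) k *v b_vec b \<mu>) $ i)"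
  have "cost \<mu> i = limsup ?p"
    unfolding series_cost_def
    by (rule lim_imp_Limsup[symmetric]) (auto intro: summable_LIMSEQ)
  also have "\<dots> \<le> limsup (\<lambda>N. (Tpol \<mu> ^^ N) Jbar i)"
    by (intro Limsup_mono always_eventually allI) (simp add: T_pol_funpow[OF \<mu>])
  finally show "cost \<mu> i \<le> stat_cost b A Jbar \<mu> i"
    by (simp add: stat_cost_def)
qed

lemma cost_le_of_T_pol_le:
  assumes \<mu>: "\<mu> \<in> stat_policies U" and "Tpol \<mu> J \<le> J"
  shows "cost \<mu> \<le> J"
proof (rule le_funI)
  fix i
  have "(\<Sum>k<N. ennreal ((mat_power (A_mat A \<mu>) k *v b_vec b \<mu>) $ i)) \<le> J i" for N
  proof -
    have "(\<Sum>k<N. ennreal ((mat_power (A_mat A \<mu>) k *v b_vec b \<mu>) $ i)) \<le> (Tpol \<mu> ^^ N) J i"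
      by (simp add: T_pol_funpow[OF \<mu>])
    also have "\<dots> \<le> J i"
      using funpow_le_of_le[OF mono_T_pol assms(2)] by (simp add: le_fun_def)
    finally show ?thesis .
  qed
  then show "cost \<mu> i \<le> J i"
    unfolding series_cost_def by (intro suminf_le_const) auto
qed

lemma le_cost_of_le_T_pol:
  assumes "contractive U A \<mu>" "J \<in> finite_vecs" "J \<le> Tpol \<mu> J"
  shows "J \<le> cost \<mu>"
proof (rule le_funI)
  fix i
  have "J i \<le> (Tpol \<mu> ^^ N) J i" for N
    using le_funpow_of_le[OF mono_T_pol assms(3)] by (simp add: le_fun_def)
  then show "J i \<le> cost \<mu> i"
    by (intro Lim_bounded2[OF T_pol_funpow_tendsto_cost[OF assms(1,2)]]) auto
qed

lemma T_opt_finite: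
  assumes "J \<in> finite_vecs"
  shows "T J \<in> finite_vecs"
proof -
  have "T J i < \<infinity>" for i
  proof -
    obtain u where u: "u \<in> U i"
      using U_nonempty by blast
    have "T J i \<le> stage_value b A i u J"
      unfolding T_opt_def by (rule INF_lower[OF u])
    also have "\<dots> < \<infinity>"
      using assms by (auto simp: stage_value_def finite_vecs_def ennreal_mult_less_top)
    finally show ?thesis .
  qed
  then show ?thesis
    by (simp add: finite_vecs_def)
qed

end

section \<open>Fixed points and value iteration\<close>

locale affine_monotonic_compact = affine_monotonic U b A
  for U :: "'n::finite \<Rightarrow> 'u::metric_space set" and b A +
  assumes ex_contractive: "\<exists>\<mu>. contractive U A \<mu>"
    and compact_level: "\<And>i (l::real) (J :: 'n \<Rightarrow> real). (\<And>j. 0 \<le> J j) \<Longrightarrow>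
           compact {u \<in> U i. b i u + (\<Sum>j\<in>UNIV. A i j u * J j) \<le> l}"
    and noncontractive_infinite:
      "\<And>\<mu>. \<mu> \<in> stat_policies U \<Longrightarrow> \<not> contractive U A \<mu> \<Longrightarrow> \<exists>i. series_cost b A \<mu> i = \<infinity>"
begin

lemma contractive_if_cost_finite:
  assumes "\<mu> \<in> stat_policies U" "cost \<mu> \<in> finite_vecs"
  shows "contractive U A \<mu>"
proof (rule ccontr)
  assume "\<not> contractive U A \<mu>"
  then obtain i where "cost \<mu> i = \<infinity>"
    using noncontractive_infinite[OF assms(1)] by blast
  then show False
    using assms(2) by (simp add: finite_vecs_def less_le)
qed

text \<open>
  The partial sums of the series cost stay below \<open>J\<close>, which rules out the infinite component that a
  noncontractive policy would have.
\<close>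

lemma contractive_if_T_pol_le:
  assumes "\<mu> \<in> stat_policies U" "J \<in> finite_vecs" "Tpol \<mu> J \<le> J"
  shows "contractive U A \<mu>"
  by (rule contractive_if_cost_finite[OF assms(1)
        finite_vecs_mono[OF cost_le_of_T_pol_le[OF assms(1,3)] assms(2)]])

lemma compact_level_ennreal:
  assumes J: "J \<in> finite_vecs" and l: "l < \<infinity>"
  shows "compact {u \<in> U i. stage_value b A i u J \<le> l}"
proof -
  have "stage_value b A i u J \<le> l \<longleftrightarrow>
      b i u + (\<Sum>j\<in>UNIV. A i j u * enn2real (J j)) \<le> enn2real l" if u: "u \<in> U i" for u
  proof -
    let ?s = "\<Sum>j\<in>UNIV. A i j u * enn2real (J j)"
    have "ennreal (A i j u) * J j = ennreal (A i j u * enn2real (J j))" for j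
      using J A_nonneg[OF u] by (simp add: ennreal_mult finite_vecs_def)
    then have "stage_value b A i u J = ennreal (b i u + ?s)"
      using b_nonneg[OF u] A_nonneg[OF u]
      by (simp add: stage_value_def sum_ennreal ennreal_plus sum_nonneg)
    moreover obtain r where "l = ennreal r" "0 \<le> r"
      using l by (cases l) auto
    ultimately show ?thesis
      by simp
  qed
  then have "{u \<in> U i. stage_value b A i u J \<le> l} =
      {u \<in> U i. b i u + (\<Sum>j\<in>UNIV. A i j u * enn2real (J j)) \<le> enn2real l}"
    by blast
  then show ?thesis
    using compact_level[of "\<lambda>j. enn2real (J j)"] by simp
qed

text \<open>
  When the vectors increase and the levels decrease, the level sets are nested, and compactness
  yields a common point. Constant vectors with levels falling to \<open>T J i\<close> give a minimizer in the
  definition of \<open>T\<close>; a constant level with increasing vectors lets \<open>T\<close> pass to their limit.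
\<close>

lemma nested_level_sets:
  assumes J: "\<And>m. J m \<in> finite_vecs" "incseq J"
    and l: "\<And>m. l m < \<infinity>" "decseq l"
    and ne: "\<And>m. \<exists>u\<in>U i. stage_value b A i u (J m) \<le> l m"
  obtains u where "u \<in> U i" "\<And>m. stage_value b A i u (J m) \<le> l m"
proof -
  define S where "S m = {u \<in> U i. stage_value b A i u (J m) \<le> l m}" for m
  have cpt: "compact (S m)" for m
    unfolding S_def by (intro compact_level_ennreal J l)
  have anti: "S n \<subseteq> S m" if "m \<le> n" for m n
  proof
    fix u assume u: "u \<in> S n"
    have "stage_value b A i u (J m) \<le> stage_value b A i u (J n)"
      by (rule stage_value_mono[OF incseqD[OF J(2) that]])
    also have "\<dots> \<le> l n"
      using u by (simp add: S_def)
    also have "\<dots> \<le> l m"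
      by (rule decseqD[OF l(2) that])
    finally show "u \<in> S m"
      using u by (simp add: S_def)
  qed
  have "S 0 \<inter> (\<Inter>m\<in>UNIV. S m) \<noteq> {}"
  proof (rule compact_imp_fip_image[OF cpt])
    show "closed (S m)" for m
      by (rule compact_imp_closed[OF cpt])
    fix I :: "nat set"
    assume "finite I"
    then have "S (Max (insert 0 I)) \<subseteq> S 0 \<inter> (\<Inter>m\<in>I. S m)"
      by (intro Int_greatest INT_greatest anti Max_ge) auto
    moreover have "S (Max (insert 0 I)) \<noteq> {}"
      using ne by (simp add: S_def Bex_def)
    ultimately show "S 0 \<inter> (\<Inter>m\<in>I. S m) \<noteq> {}"
      by blast
  qed
  then obtain u where "u \<in> (\<Inter>m. S m)"
    by auto
  then show thesis
    by (intro that[of u]) (auto simp: S_def)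
qed

lemma ex_greedy_policy:
  assumes J: "J \<in> finite_vecs"
  obtains \<mu> where "\<mu> \<in> stat_policies U" "Tpol \<mu> J = T J"
proof -
  have "\<exists>u. u \<in> U i \<and> stage_value b A i u J = T J i" for i
  proof -
    define l where "l m = T J i + ennreal (inverse (Suc m))" for m
    have TJ: "T J i < \<infinity>"
      using T_opt_finite[OF J] by (simp add: finite_vecs_def)
    have fin: "l m < \<infinity>" for m
      using TJ by (simp add: l_def)
    have decr: "decseq l"
      unfolding l_def decseq_def by (auto intro!: add_left_mono ennreal_leI le_imp_inverse_le)
    have ne: "\<exists>u\<in>U i. stage_value b A i u J \<le> l m" for m
    proof -
      have "T J i < l m"
        using TJ ennreal_add_left_cancel_less[of "T J i" 0] by (simp add: l_def)
      then show ?thesis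
        unfolding T_opt_def INF_less_iff by (auto intro: less_imp_le)
    qed
    obtain u where u: "u \<in> U i" "\<And>m. stage_value b A i u J \<le> l m"
      by (rule nested_level_sets[OF J _ fin decr ne]) (auto simp: incseq_def)
    have "l \<longlonglongrightarrow> T J i + ennreal 0"
      unfolding l_def by (intro tendsto_intros tendsto_ennrealI LIMSEQ_inverse_real_of_nat)
    then have "stage_value b A i u J \<le> T J i"
      using u(2) by (auto intro: Lim_bounded2)
    moreover have "T J i \<le> stage_value b A i u J"
      unfolding T_opt_def by (rule INF_lower[OF u(1)])
    ultimately show ?thesis
      using u(1) by (auto intro: antisym)
  qed
  then obtain \<mu> where "\<And>i. \<mu> i \<in> U i \<and> stage_value b A i (\<mu> i) J = T J i"
    by metis
  then show thesis
    using that by (auto simp: stat_policies_def T_pol_def)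
qed

lemma fixed_point_is_cost:
  assumes J: "J \<in> finite_vecs" and fixed: "T J = J"
  obtains \<mu> where "contractive U A \<mu>" "cost \<mu> = J"
proof -
  obtain \<mu> where \<mu>: "\<mu> \<in> stat_policies U" "Tpol \<mu> J = J"
    using ex_greedy_policy[OF J] unfolding fixed .
  have c: "contractive U A \<mu>"
    using contractive_if_T_pol_le[OF \<mu>(1) J] \<mu>(2) by simp
  moreover have "cost \<mu> = J"
    using cost_le_of_T_pol_le[OF \<mu>(1), of J] le_cost_of_le_T_pol[OF c J] \<mu>(2)
    by (auto intro: antisym)
  ultimately show thesis
    by (rule that)
qed

text \<open>
  For a policy \<open>\<mu>\<close> with \<open>cost \<mu> = J'\<close>, iterating \<open>J \<le> T J \<le> Tpol \<mu> J\<close> gives \<open>J \<le> cost \<mu>\<close>.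
\<close>

lemma le_fixed_point:
  assumes "J \<in> finite_vecs" "J \<le> T J" and J': "J' \<in> finite_vecs" "T J' = J'"
  shows "J \<le> J'"
proof -
  obtain \<mu> where \<mu>: "contractive U A \<mu>" "cost \<mu> = J'"
    using fixed_point_is_cost[OF J'] .
  have "J \<le> Tpol \<mu> J"
    using assms(2) T_opt_le_T_pol[OF contractive_stat[OF \<mu>(1)]] by (rule order_trans)
  then show ?thesis
    using le_cost_of_le_T_pol[OF \<mu>(1) assms(1)] \<mu>(2) by simp
qed

lemma fixed_point_unique:
  assumes "J \<in> finite_vecs" "T J = J" "J' \<in> finite_vecs" "T J' = J'"
  shows "J = J'"
  using assms le_fixed_point[of J J'] le_fixed_point[of J' J] by (simp add: antisym)

text \<open>
  From \<open>0\<close> the iterates increase and stay below the cost of a contractive policy, so they have a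
  finite limit \<open>J\<close>. Monotonicity gives \<open>J \<le> T J\<close> only; for the converse, a single control must
  satisfy the level constraint \<open>J i\<close> for all iterates at once, as \<open>nested_level_sets\<close> provides.
\<close>

lemma ex_value_iteration_limit_from_0:
  obtains J where "J \<in> finite_vecs" "T J = J" "\<And>i. (\<lambda>k. (T ^^ k) (\<lambda>_. 0) i) \<longlonglongrightarrow> J i"
proof -
  define V where "V k = (T ^^ k) (\<lambda>_. 0)" for k
  define J where "J i = (SUP k. V k i)" for i
  have V_Suc: "V (Suc k) = T (V k)" for k
    by (simp add: V_def)
  have "V k \<le> V (Suc k)" for k
  proof (induction k)
    case 0
    show ?case
      by (simp add: V_def le_fun_def)
  next
    case (Suc k)
    show ?case
      using monoD[OF mono_T_opt Suc] by (simp only: V_Suc)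
  qed
  then have incV: "incseq V"
    by (rule incseq_SucI)
  then have lim: "(\<lambda>k. V k i) \<longlonglongrightarrow> J i" for i
    unfolding J_def by (intro LIMSEQ_SUP) (simp add: incseq_def le_fun_def)
  have V_le: "V k \<le> J" for k
    unfolding J_def by (auto intro!: le_funI SUP_upper)
  obtain \<mu> where \<mu>: "contractive U A \<mu>"
    using ex_contractive ..
  then have "V k i \<le> (Tpol \<mu> ^^ k) (\<lambda>_. 0) i" for k i
    unfolding V_def by (intro le_funD[OF T_opt_funpow_le_T_pol_funpow] contractive_stat)
  then have "J i \<le> cost \<mu> i" for i
    by (intro LIMSEQ_le[OF lim T_pol_funpow_tendsto_cost[OF \<mu> zero_in_finite_vecs]]) blast
  then have J: "J \<in> finite_vecs"
    by (intro finite_vecs_mono[OF le_funI cost_finite[OF \<mu>]])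
  have V: "V k \<in> finite_vecs" for k
    using finite_vecs_mono[OF V_le J] .
  have "J \<le> T J"
  proof (rule le_funI)
    fix i
    have "V (Suc k) i \<le> T J i" for k
      unfolding V_Suc using monoD[OF mono_T_opt V_le] by (rule le_funD)
    then show "J i \<le> T J i"
      by (intro Lim_bounded[OF LIMSEQ_Suc[OF lim]]) auto
  qed
  moreover have "T J \<le> J"
  proof (rule le_funI)
    fix i
    have ne: "\<exists>u\<in>U i. stage_value b A i u (V m) \<le> J i" for m
    proof -
      obtain \<nu> where \<nu>: "\<nu> \<in> stat_policies U" "Tpol \<nu> (V m) = T (V m)"
        using ex_greedy_policy[OF V] .
      have "stage_value b A i (\<nu> i) (V m) = V (Suc m) i"
        using fun_cong[OF \<nu>(2), of i] by (simp add: V_Suc T_pol_def)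
      also have "\<dots> \<le> J i"
        by (rule le_funD[OF V_le])
      finally show ?thesis
        using \<nu>(1) by (auto simp: stat_policies_def)
    qed
    have "J i < \<infinity>" "decseq (\<lambda>_::nat. J i)"
      using J by (simp_all add: finite_vecs_def decseq_def)
    then obtain u where u: "u \<in> U i" "\<And>m. stage_value b A i u (V m) \<le> J i"
      using nested_level_sets[OF V incV _ _ ne] by metis
    have "stage_value b A i u J \<le> J i"
      using u(2) by (intro Lim_bounded[OF stage_value_tendsto[OF lim]]) simp
    then show "T J i \<le> J i"
      unfolding T_opt_def by (rule INF_lower2[OF u(1)])
  qed
  ultimately have "T J = J"
    by (rule antisym[rotated])
  then show thesis
    using J lim unfolding V_def by (intro that)
qed

lemma value_iteration_tendsto_fixed_point:
  assumes "J' \<in> finite_vecs" "T J' = J'" and J: "J \<in> finite_vecs"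
  shows "(\<lambda>k. (T ^^ k) J i) \<longlonglongrightarrow> J' i"
proof -
  obtain \<mu> where \<mu>: "contractive U A \<mu>" "cost \<mu> = J'"
    using fixed_point_is_cost[OF assms(1,2)] .
  have lower: "(\<lambda>k. (T ^^ k) (\<lambda>_. 0) i) \<longlonglongrightarrow> J' i"
  proof -
    obtain J0 where "J0 \<in> finite_vecs" "T J0 = J0" "\<And>i. (\<lambda>k. (T ^^ k) (\<lambda>_. 0) i) \<longlonglongrightarrow> J0 i"
      using ex_value_iteration_limit_from_0 by blast
    then show ?thesis
      using fixed_point_unique[OF assms(1,2)] by simp
  qed
  have upper: "(\<lambda>k. (Tpol \<mu> ^^ k) J i) \<longlonglongrightarrow> J' i"
    using T_pol_funpow_tendsto_cost[OF \<mu>(1) J] \<mu>(2) by simp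
  have "(T ^^ k) (\<lambda>_. 0) i \<le> (T ^^ k) J i" for k
    by (intro le_funD[OF funpow_mono[OF mono_T_opt]]) (simp add: le_fun_def)
  moreover have "(T ^^ k) J i \<le> (Tpol \<mu> ^^ k) J i" for k
    by (intro le_funD[OF T_opt_funpow_le_T_pol_funpow] contractive_stat \<mu>(1))
  ultimately show ?thesis
    by (intro tendsto_sandwich[OF _ _ lower upper]) auto
qed

section \<open>The optimal cost\<close>

text \<open>
  The cost of an arbitrary policy is at least the limit of value iteration started at the same
  terminal vector, while a contractive stationary policy attains that limit.
\<close>

lemma fixed_point_eq_opt_cost:
  assumes J: "J \<in> finite_vecs" "T J = J" and Jbar: "Jbar \<in> finite_vecs"
  shows "J = opt_cost U b A Jbar"
proof (rule antisym; rule le_funI)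
  fix i
  show "J i \<le> opt_cost U b A Jbar i"
    unfolding opt_cost_def
  proof (rule INF_greatest)
    fix \<pi> assume \<pi>: "\<pi> \<in> policies U"
    have "J i = limsup (\<lambda>N. (T ^^ N) Jbar i)"
      using value_iteration_tendsto_fixed_point[OF J Jbar]
      by (intro lim_imp_Limsup[symmetric]) auto
    also have "\<dots> \<le> policy_cost b A Jbar \<pi> i"
      unfolding policy_cost_def
      by (intro Limsup_mono always_eventually allI le_funD[OF T_opt_funpow_le_foldr[OF \<pi>]])
    finally show "J i \<le> policy_cost b A Jbar \<pi> i" .
  qed
next
  fix i
  obtain \<mu> where \<mu>: "contractive U A \<mu>" "cost \<mu> = J"
    using fixed_point_is_cost[OF J] .
  then have "(\<lambda>_. \<mu>) \<in> policies U"
    by (simp add: policies_def contractive_def)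
  then have "opt_cost U b A Jbar i \<le> policy_cost b A Jbar (\<lambda>_. \<mu>) i"
    unfolding opt_cost_def by (rule INF_lower)
  also have "\<dots> = J i"
    using stat_cost_eq_cost[OF \<mu>(1) Jbar] \<mu>(2) by (simp add: policy_cost_const)
  finally show "opt_cost U b A Jbar i \<le> J i" .
qed

context
  fixes Jbar :: "'n \<Rightarrow> ennreal"
  assumes Jbar: "Jbar \<in> finite_vecs"
begin

abbreviation Jopt where "Jopt \<equiv> opt_cost U b A Jbar"

lemma opt_cost_fixed_point: "T Jopt = Jopt" "Jopt \<in> finite_vecs"
proof -
  obtain J where J: "J \<in> finite_vecs" "T J = J"
    using ex_value_iteration_limit_from_0 by blast
  have "J = Jopt"
    by (rule fixed_point_eq_opt_cost[OF J Jbar])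
  with J show "T Jopt = Jopt" "Jopt \<in> finite_vecs"
    by simp_all
qed

lemma value_iteration_tendsto_opt_cost:
  "J \<in> finite_vecs \<Longrightarrow> (\<lambda>k. (T ^^ k) J i) \<longlonglongrightarrow> Jopt i"
  by (rule value_iteration_tendsto_fixed_point[OF opt_cost_fixed_point(2,1)])

lemma le_opt_cost:
  "J \<in> finite_vecs \<Longrightarrow> J \<le> T J \<Longrightarrow> J \<le> Jopt"
  by (rule le_fixed_point[OF _ _ opt_cost_fixed_point(2,1)])

lemma opt_cost_le:
  assumes "J \<in> finite_vecs" "T J \<le> J"
  shows "Jopt \<le> J"
proof (rule le_funI)
  fix i
  have "(T ^^ k) J i \<le> J i" for k
    by (rule le_funD[OF funpow_le_of_le[OF mono_T_opt assms(2)]])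
  then show "Jopt i \<le> J i"
    by (intro Lim_bounded[OF value_iteration_tendsto_opt_cost[OF assms(1)]]) auto
qed

text \<open>
  The optimal cost is finite, and the cost of a stationary policy dominates its series.
\<close>

lemma contractive_if_stat_optimal:
  assumes "stat_optimal U b A Jbar \<mu>"
  shows "contractive U A \<mu>"
proof (rule contractive_if_cost_finite)
  show \<mu>: "\<mu> \<in> stat_policies U"
    using assms by (simp add: stat_optimal_def)
  have "cost \<mu> \<le> Jopt"
    using cost_le_stat_cost[OF \<mu>, of Jbar] assms by (simp add: stat_optimal_def)
  then show "cost \<mu> \<in> finite_vecs"
    using opt_cost_fixed_point(2) by (rule finite_vecs_mono)
qed

lemma stat_optimal_if_T_pol_le:
  assumes \<mu>: "\<mu> \<in> stat_policies U" and "Tpol \<mu> Jopt \<le> Jopt"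
  shows "stat_optimal U b A Jbar \<mu>"
proof -
  have c: "contractive U A \<mu>"
    using contractive_if_T_pol_le[OF \<mu> opt_cost_fixed_point(2) assms(2)] .
  have "Jopt \<le> Tpol \<mu> Jopt"
    using T_opt_le_T_pol[OF \<mu>, of b A Jopt] opt_cost_fixed_point(1) by simp
  then have "Jopt \<le> cost \<mu>"
    by (rule le_cost_of_le_T_pol[OF c opt_cost_fixed_point(2)])
  moreover have "cost \<mu> \<le> Jopt"
    by (rule cost_le_of_T_pol_le[OF assms])
  ultimately show ?thesis
    using stat_cost_eq_cost[OF c Jbar] \<mu> by (simp add: stat_optimal_def antisym)
qed

lemma stat_optimal_iff:
  assumes "\<mu> \<in> stat_policies U"
  shows "stat_optimal U b A Jbar \<mu> \<longleftrightarrow> Tpol \<mu> Jopt = T Jopt"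
proof
  assume opt: "stat_optimal U b A Jbar \<mu>"
  then have c: "contractive U A \<mu>"
    by (rule contractive_if_stat_optimal)
  have "Jopt = cost \<mu>"
    using stat_cost_eq_cost[OF c Jbar] opt by (simp add: stat_optimal_def)
  then show "Tpol \<mu> Jopt = T Jopt"
    using T_pol_cost[OF c] opt_cost_fixed_point(1) by simp
next
  assume "Tpol \<mu> Jopt = T Jopt"
  then show "stat_optimal U b A Jbar \<mu>"
    using stat_optimal_if_T_pol_le[OF assms] opt_cost_fixed_point(1) by simp
qed

section \<open>Policy iteration\<close>

context
  fixes \<mu> :: "nat \<Rightarrow> 'n \<Rightarrow> 'u"
  assumes PI: "policy_iteration U b A Jbar \<mu>"
begin

text \<open>
  The greedy choice gives \<open>T\<^bsub>\<mu> (k+1)\<^esub> J = T J \<le> T\<^bsub>\<mu> k\<^esub> J = J\<close> for the cost \<open>J\<close> of \<open>\<mu> k\<close>, so that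
  contractivity passes from \<open>\<mu> k\<close> to \<open>\<mu> (k+1)\<close>.
\<close>

lemma policy_iteration_contractive: "contractive U A (\<mu> k)"
proof (induction k)
  case 0
  then show ?case
    using PI by (simp add: policy_iteration_def)
next
  case (Suc k)
  let ?J = "stat_cost b A Jbar (\<mu> k)"
  have J: "?J \<in> finite_vecs"
    using stat_cost_eq_cost[OF Suc Jbar] cost_finite[OF Suc] by simp
  have "Tpol (\<mu> (Suc k)) ?J = T ?J"
    using PI by (simp add: policy_iteration_def)
  also have "\<dots> \<le> Tpol (\<mu> k) ?J"
    by (intro T_opt_le_T_pol contractive_stat Suc)
  also have "\<dots> = ?J"
    using PI by (simp add: policy_iteration_def)
  finally show ?case
    using PI J by (intro contractive_if_T_pol_le) (auto simp: policy_iteration_def)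
qed

lemma policy_iteration_improves:
  shows "T (cost (\<mu> k)) \<le> cost (\<mu> k)"
    and "Tpol (\<mu> (Suc k)) (cost (\<mu> k)) = T (cost (\<mu> k))"
    and "cost (\<mu> (Suc k)) \<le> T (cost (\<mu> k))"
proof -
  note c = policy_iteration_contractive
  note stat = contractive_stat[OF c]
  show le: "T (cost (\<mu> k)) \<le> cost (\<mu> k)"
    using T_opt_le_T_pol[OF stat, of b A "cost (\<mu> k)" k] T_pol_cost[OF c] by simp
  show eq: "Tpol (\<mu> (Suc k)) (cost (\<mu> k)) = T (cost (\<mu> k))"
    using PI stat_cost_eq_cost[OF c Jbar] by (simp add: policy_iteration_def)
  have "cost (\<mu> (Suc k)) \<le> cost (\<mu> k)"
    using le eq by (intro cost_le_of_T_pol_le[OF stat]) simp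
  then have "Tpol (\<mu> (Suc k)) (cost (\<mu> (Suc k))) \<le> Tpol (\<mu> (Suc k)) (cost (\<mu> k))"
    by (rule monoD[OF mono_T_pol])
  then show "cost (\<mu> (Suc k)) \<le> T (cost (\<mu> k))"
    using T_pol_cost[OF c] eq by simp
qed

lemma policy_iteration_cost_decseq: "decseq (\<lambda>k. cost (\<mu> k))"
  using policy_iteration_improves(1,3) by (intro decseq_SucI) (blast intro: order_trans)

lemma opt_cost_le_policy_iteration_cost: "Jopt \<le> cost (\<mu> k)"
  by (intro opt_cost_le cost_finite policy_iteration_contractive policy_iteration_improves)

lemma policy_iteration_cost_le_value_iteration: "cost (\<mu> k) \<le> (T ^^ k) (cost (\<mu> 0))"
proof (induction k)
  case (Suc k)
  have "cost (\<mu> (Suc k)) \<le> T (cost (\<mu> k))"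
    by (rule policy_iteration_improves)
  also have "\<dots> \<le> T ((T ^^ k) (cost (\<mu> 0)))"
    by (rule monoD[OF mono_T_opt Suc])
  finally show ?case
    by simp
qed simp

lemma policy_iteration_cost_tendsto: "(\<lambda>k. cost (\<mu> k) i) \<longlonglongrightarrow> Jopt i"
proof (rule tendsto_sandwich)
  show "\<forall>\<^sub>F k in sequentially. Jopt i \<le> cost (\<mu> k) i"
    by (intro always_eventually allI le_funD[OF opt_cost_le_policy_iteration_cost])
  show "\<forall>\<^sub>F k in sequentially. cost (\<mu> k) i \<le> (T ^^ k) (cost (\<mu> 0)) i"
    by (intro always_eventually allI le_funD[OF policy_iteration_cost_le_value_iteration])
  show "(\<lambda>k. (T ^^ k) (cost (\<mu> 0)) i) \<longlonglongrightarrow> Jopt i"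
    by (intro value_iteration_tendsto_opt_cost cost_finite policy_iteration_contractive)
qed (rule tendsto_const)

text \<open>
  For \<open>k > m\<close>, the control \<open>\<mu> k i\<close> lies in the level set of \<open>u \<mapsto> stage_value b A i u Jopt\<close> for
  the level \<open>cost (\<mu> m) i\<close>. That set is closed, so the \<open>i\<close>-th component of the limit
  point belongs to it for every \<open>m\<close>, and the levels decrease to \<open>Jopt i\<close>. In particular the limit point
  satisfies the control constraints.
\<close>

lemma policy_iteration_limit_point_optimal:
  assumes "seq_limit_point \<mu> \<nu>"
  shows "stat_optimal U b A Jbar \<nu>"
proof -
  obtain r where r: "strict_mono r" "(\<mu> \<circ> r) \<longlonglongrightarrow> \<nu>"
    using assms by (auto simp: seq_limit_point_def)
  have lim: "(\<lambda>k. \<mu> (r k) i) \<longlonglongrightarrow> \<nu> i" for i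
    using continuous_on_tendsto_compose[OF continuous_on_product_coordinates r(2)]
    by (simp add: o_def)
  define S where "S i m = {u \<in> U i. stage_value b A i u Jopt \<le> cost (\<mu> m) i}" for i m
  have in_S: "\<mu> k i \<in> S i m" if "m < k" for i k m
  proof -
    obtain k' where k': "k = Suc k'" "m \<le> k'"
      using \<open>m < k\<close> by (auto simp: less_eq_Suc_le dest: Suc_le_D)
    have "stage_value b A i (\<mu> k i) Jopt \<le> stage_value b A i (\<mu> k i) (cost (\<mu> k'))"
      by (rule stage_value_mono[OF opt_cost_le_policy_iteration_cost])
    also have "\<dots> = T (cost (\<mu> k')) i"
      using fun_cong[OF policy_iteration_improves(2)[of k'], of i] k'(1) by (simp add: T_pol_def)
    also have "\<dots> \<le> cost (\<mu> k') i"
      by (rule le_funD[OF policy_iteration_improves(1)])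
    also have "\<dots> \<le> cost (\<mu> m) i"
      by (rule le_funD[OF decseqD[OF policy_iteration_cost_decseq k'(2)]])
    finally show ?thesis
      using contractive_stat[OF policy_iteration_contractive, of k]
      by (simp add: S_def stat_policies_def)
  qed
  have "eventually (\<lambda>k. m < r k) sequentially" for m
    using filterlim_subseq[OF r(1)] eventually_gt_at_top unfolding filterlim_iff by blast
  then have ev: "eventually (\<lambda>k. \<mu> (r k) i \<in> S i m) sequentially" for i m
    by (rule eventually_mono) (rule in_S)
  have closed: "closed (S i m)" for i m
    unfolding S_def
    using cost_finite[OF policy_iteration_contractive] opt_cost_fixed_point(2)
    by (intro compact_imp_closed compact_level_ennreal) (auto simp: finite_vecs_def)
  have \<nu>: "\<nu> i \<in> S i m" for i m
    by (rule Lim_in_closed_set[OF closed ev _ lim]) simp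
  then have "stage_value b A i (\<nu> i) Jopt \<le> Jopt i" for i
    using policy_iteration_cost_tendsto
    by (intro Lim_bounded2[of "\<lambda>m. cost (\<mu> m) i"]) (auto simp: S_def)
  then have "Tpol \<nu> Jopt \<le> Jopt"
    by (simp add: T_pol_def le_fun_def)
  moreover have "\<nu> \<in> stat_policies U"
    using \<nu> by (simp add: S_def stat_policies_def)
  ultimately show ?thesis
    by (intro stat_optimal_if_T_pol_le)
qed

end

end

end

section \<open>Existence, uniqueness, value iteration and policy iteration\<close>

theorem proposition3:
  fixes U :: "'n::finite \<Rightarrow> 'u::metric_space set"
    and b :: "'n \<Rightarrow> 'u \<Rightarrow> real"
    and A :: "'n \<Rightarrow> 'n \<Rightarrow> 'u \<Rightarrow> real"
    and Jbar :: "'n \<Rightarrow> ennreal"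
  assumes U_nonempty: "\<And>i. U i \<noteq> {}"
    and b_nonneg: "\<And>i u. u \<in> U i \<Longrightarrow> 0 \<le> b i u"
    and A_nonneg: "\<And>i j u. u \<in> U i \<Longrightarrow> 0 \<le> A i j u"
    and Jbar_finite: "Jbar \<in> finite_vecs"
    and ex_contractive: "\<exists>\<mu>. contractive U A \<mu>"
    and A_cont: "\<And>i j. continuous_on (U i) (A i j)"
    and b_cont: "\<And>i. continuous_on (U i) (b i)"
    and compact_level: "\<And>i (l::real) (J :: 'n \<Rightarrow> real). (\<And>j. 0 \<le> J j) \<Longrightarrow>
           compact {u \<in> U i. b i u + (\<Sum>j\<in>UNIV. A i j u * J j) \<le> l}"
    and noncontractive_infinite:
      "\<And>\<mu>. \<mu> \<in> stat_policies U \<Longrightarrow> \<not> contractive U A \<mu> \<Longrightarrow>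
         \<exists>i. (\<Sum>k. ennreal ((mat_power (A_mat A \<mu>) k *v b_vec b \<mu>) $ i)) = \<infinity>"
  shows
    "(T_opt U b A (opt_cost U b A Jbar) = opt_cost U b A Jbar \<and>
      opt_cost U b A Jbar \<in> finite_vecs \<and>
      (\<forall>J \<in> finite_vecs. T_opt U b A J = J \<longrightarrow> J = opt_cost U b A Jbar)) \<and>
     (\<forall>\<mu>. policy_iteration U b A Jbar \<mu> \<longrightarrow>
        (\<forall>k. contractive U A (\<mu> k)) \<and>
        (\<forall>\<nu>. seq_limit_point \<mu> \<nu> \<longrightarrow> contractive U A \<nu> \<and> stat_optimal U b A Jbar \<nu>)) \<and>
     (\<forall>J \<in> finite_vecs. \<forall>i. (\<lambda>k. (T_opt U b A ^^ k) J i) \<longlonglongrightarrow> opt_cost U b A Jbar i) \<and>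
     (\<forall>\<mu> \<in> stat_policies U. stat_optimal U b A Jbar \<mu> \<longleftrightarrow>
        T_pol b A \<mu> (opt_cost U b A Jbar) = T_opt U b A (opt_cost U b A Jbar)) \<and>
     (\<forall>J \<in> finite_vecs.
        (J \<le> T_opt U b A J \<longrightarrow> J \<le> opt_cost U b A Jbar) \<and>
        (T_opt U b A J \<le> J \<longrightarrow> opt_cost U b A Jbar \<le> J))"
proof -
  have infinite: "\<exists>i. series_cost b A \<mu> i = \<infinity>" if "\<mu> \<in> stat_policies U" "\<not> contractive U A \<mu>" for \<mu>
    using noncontractive_infinite[OF that] by (simp add: series_cost_def)
  interpret affine_monotonic_compact U b A
  proof unfold_locales
    show "compact {u \<in> U i. b i u + (\<Sum>j\<in>UNIV. A i j u * J j) \<le> l}"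
      if "\<And>j. 0 \<le> J j" for i and l :: real and J :: "'n \<Rightarrow> real"
      using that by (rule compact_level)
  qed (use U_nonempty b_nonneg A_nonneg ex_contractive infinite in blast)+
  note Jopt = opt_cost_fixed_point[OF Jbar_finite]
  show ?thesis
  proof (intro conjI ballI allI impI)
    show "T (opt_cost U b A Jbar) = opt_cost U b A Jbar" and "opt_cost U b A Jbar \<in> finite_vecs"
      by (fact Jopt)+
    show "J = opt_cost U b A Jbar" if "J \<in> finite_vecs" "T J = J" for J
      using that Jopt(2,1) by (rule fixed_point_unique)
    show "contractive U A (\<mu> k)" if "policy_iteration U b A Jbar \<mu>" for \<mu> k
      by (rule policy_iteration_contractive[OF Jbar_finite that])
    fix \<mu> \<nu> assume "policy_iteration U b A Jbar \<mu>" "seq_limit_point \<mu> \<nu>"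
    then show opt: "stat_optimal U b A Jbar \<nu>"
      by (rule policy_iteration_limit_point_optimal[OF Jbar_finite])
    then show "contractive U A \<nu>"
      by (rule contractive_if_stat_optimal[OF Jbar_finite])
  next
    fix J :: "'n \<Rightarrow> ennreal" and i assume J: "J \<in> finite_vecs"
    show "(\<lambda>k. (T ^^ k) J i) \<longlonglongrightarrow> opt_cost U b A Jbar i"
      by (rule value_iteration_tendsto_opt_cost[OF Jbar_finite J])
    show "J \<le> opt_cost U b A Jbar" if "J \<le> T J"
      by (rule le_opt_cost[OF Jbar_finite J that])
    show "opt_cost U b A Jbar \<le> J" if "T J \<le> J"
      by (rule opt_cost_le[OF Jbar_finite J that])
  next
    show "stat_optimal U b A Jbar \<mu> \<longleftrightarrow> Tpol \<mu> (opt_cost U b A Jbar) = T (opt_cost U b A Jbar)"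
      if "\<mu> \<in> stat_policies U" for \<mu>
      by (rule stat_optimal_iff[OF Jbar_finite that])
  qed
qed

end
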